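(* Let $X$ be one of the real sequence spaces $c_0$, $c$, or $l_p$ with $1\le p<\infty$. Let $A\in\mathcal{B}(X)\cap\mathcal{F}(X)$, let $B\subset\mathbb{R}$ be a meager set of positive Lebesgue measure, and let $S:=B\times A\subset\mathbb{R}\times X$, regarded as a subset of $X$ via the identification $\mathbb{R}\times X=X$. Then $S$ is Haar meager (consequently meager) in $X$, but $S$ is not Haar null in $X$. In particular, $X$ contains a set which is Haar meager (hence meager) but not Haar null.
   Context: An abelian Polish group is a topological abelian group whose topology is given by a complete separable metric; the spaces $c_0$ (real sequences converging to $0$, sup norm), $c$ (convergent real sequences, sup norm) and $l_p$ (real $p$-summable sequences, $p$-norm) are considered as abelian Polish groups under addition. For an abelian Polish group $X$, $\mathcal{B}(X)$ denotes the Borel $\sigma$-algebra on $X$, and $\mathcal{F}(X)$ denotes the family of all sets $A\subset X$ such that for every compact $K\subset X$ there is $x_K\in X$ with $K+x_K\subset A$. A set $A\subset X$ is Haar null if there are a Borel probability measure $\mu$ on $X$ and a Borel set $B\subset X$ such that $A\subset B$ and $\mu(x+B)=0$ for all $x\in X$. A set $A\subset X$ is Haar meager if there are a Borel set $B\subset X$ with $A\subset B$, a nonempty compact metric space $K$ and a continuous function $f:K\to X$ such that $f^{-1}(B+x)$ is meager in $K$ for all $x\in X$. For $X\in\{c_0,c,l_p\}$, the identification $\mathbb{R}\times X=X$ is the topological group isomorphism $(t,(x_1,x_2,\dots))\mapsto(t,x_1,x_2,\dots)$. *)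

theory Defs
  imports "HOL-Analysis.Analysis" "HOL-Probability.Probability" "HOL-Library.Function_Algebras"
begin

section \<open>The sequence spaces\<close>

text \<open>
  Sequences are indexed from \<open>0\<close> and added pointwise.  Every space is an abstract metric
  space whose carrier is a subgroup of \<open>nat \<Rightarrow> real\<close>.
\<close>

definition c0_seqs :: "(nat \<Rightarrow> real) set" where
  "c0_seqs = {x. x \<longlonglongrightarrow> 0}"

definition c_seqs :: "(nat \<Rightarrow> real) set" where
  "c_seqs = {x. convergent x}"

definition lp_seqs :: "real \<Rightarrow> (nat \<Rightarrow> real) set" where
  "lp_seqs p = {x. summable (\<lambda>n. \<bar>x n\<bar> powr p)}"

text \<open>
  The value on unbounded sequences is irrelevant, but \<^locale>\<open>Metric_space\<close> demands
  nonnegativity of the distance function outside the carrier as well.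
\<close>

definition sup_norm :: "(nat \<Rightarrow> real) \<Rightarrow> real" where
  "sup_norm x = (if bounded (range x) then (SUP n. \<bar>x n\<bar>) else 0)"

definition lp_norm :: "real \<Rightarrow> (nat \<Rightarrow> real) \<Rightarrow> real" where
  "lp_norm p x = (\<Sum>n. \<bar>x n\<bar> powr p) powr (1 / p)"

definition c0_metric :: "(nat \<Rightarrow> real) metric" where
  "c0_metric = metric (c0_seqs, \<lambda>x y. sup_norm (x - y))"

definition c_metric :: "(nat \<Rightarrow> real) metric" where
  "c_metric = metric (c_seqs, \<lambda>x y. sup_norm (x - y))"

definition lp_metric :: "real \<Rightarrow> (nat \<Rightarrow> real) metric" where
  "lp_metric p = metric (lp_seqs p, \<lambda>x y. lp_norm p (x - y))"

text \<open>The identification \<open>\<real> \<times> X = X\<close>.\<close>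

definition prepend :: "real \<times> (nat \<Rightarrow> real) \<Rightarrow> nat \<Rightarrow> real" where
  "prepend = (\<lambda>(t, x). case_nat t x)"


section \<open>Meager sets, Haar null sets, Haar meager sets\<close>

definition nowhere_dense_in :: "'a topology \<Rightarrow> 'a set \<Rightarrow> bool" where
  "nowhere_dense_in T A \<longleftrightarrow> A \<subseteq> topspace T \<and> T interior_of (T closure_of A) = {}"

definition meager_in :: "'a topology \<Rightarrow> 'a set \<Rightarrow> bool" where
  "meager_in T A \<longleftrightarrow> (\<exists>F :: nat \<Rightarrow> 'a set. (\<forall>n. nowhere_dense_in T (F n)) \<and> A = (\<Union>n. F n))"

definition borel_of :: "'a topology \<Rightarrow> 'a measure" where
  "borel_of T = sigma (topspace T) {U. openin T U}"

text \<open>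
  In the following definitions \<open>T\<close> is the topology of an abelian Polish group whose carrier
  \<open>topspace T\<close> is a subgroup of the ambient additive group.
\<close>

definition catches_compacts :: "'a::ab_group_add topology \<Rightarrow> 'a set set" where
  "catches_compacts T =
     {A. A \<subseteq> topspace T \<and>
         (\<forall>K. compactin T K \<longrightarrow> (\<exists>x\<in>topspace T. (\<lambda>k. k + x) ` K \<subseteq> A))}"

definition haar_null :: "'a::ab_group_add topology \<Rightarrow> 'a set \<Rightarrow> bool" where
  "haar_null T A \<longleftrightarrow>
     (\<exists>\<mu> B. prob_space \<mu> \<and> sets \<mu> = sets (borel_of T) \<and> B \<in> sets (borel_of T) \<and> A \<subseteq> B \<and>
            (\<forall>x\<in>topspace T. emeasure \<mu> ((\<lambda>b. x + b) ` B) = 0))"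

text \<open>
  A definition cannot quantify over types, so the points of the compact metric space are taken
  to be real numbers, with an arbitrary metric.  This is no restriction, as a compact metric
  space has at most continuum many points: see \<open>haar_meagerI\<close> below.
\<close>

definition haar_meager :: "'a::ab_group_add topology \<Rightarrow> 'a set \<Rightarrow> bool" where
  "haar_meager T A \<longleftrightarrow>
     (\<exists>B \<in> sets (borel_of T). A \<subseteq> B \<and>
       (\<exists>(K :: real metric) f.
          compact_space (mtopology_of K) \<and> mspace K \<noteq> {} \<and>
          continuous_map (mtopology_of K) T f \<and>
          (\<forall>x\<in>topspace T. meager_in (mtopology_of K) {k \<in> mspace K. f k \<in> (\<lambda>b. b + x) ` B})))"


section \<open>The spaces are metric spaces\<close>

lemma sup_norm_ge: "bounded (range x) \<Longrightarrow> \<bar>x n\<bar> \<le> sup_norm x"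
  unfolding sup_norm_def
  by (auto intro!: cSUP_upper simp: bounded_iff bdd_above_def)

lemma sup_norm_le: "bounded (range x) \<Longrightarrow> (\<And>n. \<bar>x n\<bar> \<le> b) \<Longrightarrow> sup_norm x \<le> b"
  unfolding sup_norm_def by (auto intro!: cSUP_least)

lemma sup_norm_nonneg: "0 \<le> sup_norm x"
proof (cases "bounded (range x)")
  case True
  then show ?thesis using sup_norm_ge[of x 0] by linarith
qed (simp add: sup_norm_def)

lemma sup_norm_minus_commute: "sup_norm (x - y) = sup_norm (y - x)"
proof -
  have "bounded (range (x - y)) \<longleftrightarrow> bounded (range (y - x))"
    by (simp add: bounded_iff abs_minus_commute)
  then show ?thesis by (simp add: sup_norm_def abs_minus_commute)
qed

lemma Metric_space_sup:
  assumes M: "\<And>x. x \<in> M \<Longrightarrow> convergent x"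
  shows "Metric_space M (\<lambda>x y. sup_norm (x - y))"
proof
  have bdd: "bounded (range (x - y))" if "x \<in> M" "y \<in> M" for x y
    using convergent_imp_Bseq[OF convergent_diff[OF M[OF that(1)] M[OF that(2)]]]
    by (simp add: Bseq_eq_bounded fun_diff_def)
  fix x y z :: "nat \<Rightarrow> real"
  show "0 \<le> sup_norm (x - y)" by (rule sup_norm_nonneg)
  show "sup_norm (x - y) = sup_norm (y - x)" by (rule sup_norm_minus_commute)
  assume x: "x \<in> M" and y: "y \<in> M"
  show "sup_norm (x - y) = 0 \<longleftrightarrow> x = y"
  proof
    assume 0: "sup_norm (x - y) = 0"
    have "x n = y n" for n using sup_norm_ge[OF bdd[OF x y], of n] 0 by simp
    then show "x = y" by auto
  next
    assume "x = y" then show "sup_norm (x - y) = 0" by (simp add: sup_norm_def zero_fun_def)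
  qed
  assume z: "z \<in> M"
  show "sup_norm (x - z) \<le> sup_norm (x - y) + sup_norm (y - z)"
  proof (rule sup_norm_le[OF bdd[OF x z]])
    fix n
    show "\<bar>(x - z) n\<bar> \<le> sup_norm (x - y) + sup_norm (y - z)"
      using sup_norm_ge[OF bdd[OF x y], of n] sup_norm_ge[OF bdd[OF y z], of n] by simp
  qed
qed

lemma Metric_space_c0: "Metric_space c0_seqs (\<lambda>x y. sup_norm (x - y))"
  by (rule Metric_space_sup) (auto simp: c0_seqs_def convergent_def)

lemma Metric_space_c: "Metric_space c_seqs (\<lambda>x y. sup_norm (x - y))"
  by (rule Metric_space_sup) (auto simp: c_seqs_def)

lemma powr_add_convex:
  fixes a b A B p :: real
  assumes "1 \<le> p" "0 \<le> a" "0 \<le> b" "0 < A" "0 < B"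
  shows "((a + b) / (A + B)) powr p \<le> A / (A + B) * (a / A) powr p + B / (A + B) * (b / B) powr p"
proof -
  have scale: "(c / (A + B)) powr p \<le> C / (A + B) * (c / C) powr p"
    if "0 \<le> c" "0 < C" "C < A + B" for c C
  proof -
    have "(c / (A + B)) powr p = (C / (A + B)) powr p * (c / C) powr p"
      using that by (simp flip: powr_mult)
    also have "(C / (A + B)) powr p \<le> (C / (A + B)) powr 1"
      using that assms by (intro powr_mono') auto
    finally show ?thesis using that by (simp add: mult_right_mono)
  qed
  consider "a = 0" | "b = 0" | "0 < a" "0 < b" using assms by linarith
  then show ?thesis
  proof cases
    case 1
    then show ?thesis using scale[of b B] assms by simp
  next
    case 2
    then show ?thesis using scale[of a A] assms by simp
  next
    case 3
    have "B / (A + B) \<ge> 0" "B / (A + B) \<le> 1" "1 - B / (A + B) = A / (A + B)"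
      using assms by (auto simp: field_simps)
    moreover have "A / (A + B) * (a / A) + B / (A + B) * (b / B) = (a + b) / (A + B)"
      using assms by (simp add: add_divide_distrib)
    ultimately show ?thesis
      using convex_onD[OF powr_convex[OF assms(1)], of "B / (A + B)" "a / A" "b / B"] 3 assms
      by (simp add: scaleR_conv_of_real)
  qed
qed

lemma lp_norm_powr:
  assumes "1 \<le> p" "x \<in> lp_seqs p"
  shows "lp_norm p x powr p = (\<Sum>n. \<bar>x n\<bar> powr p)"
  using assms by (simp add: lp_norm_def lp_seqs_def powr_powr suminf_nonneg)

lemma lp_norm_nonneg: "0 \<le> lp_norm p x"
  by (simp add: lp_norm_def)

lemma lp_norm_eq_0_iff:
  assumes "1 \<le> p" "x \<in> lp_seqs p"
  shows "lp_norm p x = 0 \<longleftrightarrow> x = 0"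
proof -
  have "lp_norm p x = 0 \<longleftrightarrow> (\<Sum>n. \<bar>x n\<bar> powr p) = 0"
    by (simp add: lp_norm_def)
  also have "\<dots> \<longleftrightarrow> (\<forall>n. \<bar>x n\<bar> powr p = 0)"
    using assms by (intro suminf_eq_zero_iff) (auto simp: lp_seqs_def)
  finally show ?thesis by (auto simp: fun_eq_iff)
qed

lemma lp_norm_triangle:
  assumes p: "1 \<le> p" and x: "x \<in> lp_seqs p" and y: "y \<in> lp_seqs p"
  shows "x + y \<in> lp_seqs p \<and> lp_norm p (x + y) \<le> lp_norm p x + lp_norm p y"
proof (cases "x = 0 \<or> y = 0")
  case True
  then show ?thesis using x y lp_norm_nonneg by auto
next
  case False
  define A B where "A = lp_norm p x" and "B = lp_norm p y"
  have A: "A > 0" and B: "B > 0"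
    using False lp_norm_eq_0_iff[OF p x] lp_norm_eq_0_iff[OF p y]
      lp_norm_nonneg[of p x] lp_norm_nonneg[of p y] by (auto simp: A_def B_def less_le)
  define g where
    "g n = A / (A + B) * (\<bar>x n\<bar> / A) powr p + B / (A + B) * (\<bar>y n\<bar> / B) powr p" for n
  have one: "(\<lambda>n. (\<bar>z n\<bar> / C) powr p) sums 1"
    if "z \<in> lp_seqs p" "C = lp_norm p z" "C > 0" for z C
  proof -
    have "(\<lambda>n. \<bar>z n\<bar> powr p) sums (C powr p)"
      using that lp_norm_powr[OF p that(1)] by (simp add: lp_seqs_def summable_sums)
    from sums_divide[OF this, of "C powr p"] show ?thesis
      using that by (simp add: powr_divide)
  qed
  have "g sums (A / (A + B) * 1 + B / (A + B) * 1)"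
    unfolding g_def using one[OF x A_def A] one[OF y B_def B] by (intro sums_add sums_mult)
  then have g: "g sums 1" using A B by (simp flip: add_divide_distrib)
  have le: "(\<bar>(x + y) n\<bar> / (A + B)) powr p \<le> g n" for n
  proof -
    have "(\<bar>(x + y) n\<bar> / (A + B)) powr p \<le> ((\<bar>x n\<bar> + \<bar>y n\<bar>) / (A + B)) powr p"
      using A B p by (intro powr_mono2 divide_right_mono) auto
    also have "\<dots> \<le> g n"
      unfolding g_def using A B p by (intro powr_add_convex) auto
    finally show ?thesis .
  qed
  have sm: "summable (\<lambda>n. (\<bar>(x + y) n\<bar> / (A + B)) powr p)"
    using le by (intro summable_comparison_test'[OF sums_summable[OF g], of 0]) auto
  have eq: "\<bar>(x + y) n\<bar> powr p = (\<bar>(x + y) n\<bar> / (A + B)) powr p * (A + B) powr p" for n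
    using A B by (simp flip: powr_mult)
  have mem: "x + y \<in> lp_seqs p"
    using summable_mult2[OF sm, of "(A + B) powr p"] unfolding lp_seqs_def mem_Collect_eq eq .
  have le1: "(\<Sum>n. (\<bar>(x + y) n\<bar> / (A + B)) powr p) \<le> 1"
    using suminf_le[OF le sm sums_summable[OF g]] sums_unique[OF g] by simp
  have "(\<Sum>n. \<bar>(x + y) n\<bar> powr p) \<le> (A + B) powr p"
    unfolding eq suminf_mult2[OF sm, of "(A + B) powr p", symmetric]
    using mult_right_mono[OF le1, of "(A + B) powr p"] by (simp only: mult_1 powr_ge_zero)
  then have "lp_norm p (x + y) \<le> ((A + B) powr p) powr (1 / p)"
    unfolding lp_norm_def using p mem
    by (intro powr_mono2) (auto intro!: suminf_nonneg simp: lp_seqs_def)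
  then show ?thesis using mem A B p by (simp add: powr_powr A_def B_def)
qed

lemma Metric_space_lp:
  assumes p: "1 \<le> p"
  shows "Metric_space (lp_seqs p) (\<lambda>x y. lp_norm p (x - y))"
proof
  have diff: "x - y \<in> lp_seqs p" if "x \<in> lp_seqs p" "y \<in> lp_seqs p" for x y
  proof -
    have "- y \<in> lp_seqs p" using that by (simp add: lp_seqs_def)
    from lp_norm_triangle[OF p that(1) this] show ?thesis by simp
  qed
  fix x y z :: "nat \<Rightarrow> real"
  show "0 \<le> lp_norm p (x - y)" by (rule lp_norm_nonneg)
  show "lp_norm p (x - y) = lp_norm p (y - x)" by (simp add: lp_norm_def abs_minus_commute)
  assume x: "x \<in> lp_seqs p" and y: "y \<in> lp_seqs p"
  show "lp_norm p (x - y) = 0 \<longleftrightarrow> x = y"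
    using lp_norm_eq_0_iff[OF p diff[OF x y]] by simp
  assume z: "z \<in> lp_seqs p"
  show "lp_norm p (x - z) \<le> lp_norm p (x - y) + lp_norm p (y - z)"
    using lp_norm_triangle[OF p diff[OF x y] diff[OF y z]] by simp
qed


section \<open>Haar meager sets can be witnessed by arbitrary compact metric spaces\<close>

lemma (in Metric_space) compact_imp_inj_real:
  assumes "compact_space mtopology"
  obtains g :: "'a \<Rightarrow> real" where "inj_on g M"
proof -
  have "mtotally_bounded M"
    using assms compactin_imp_mtotally_bounded[of M] by (simp add: compact_space_def)
  then have "\<forall>n::nat. \<exists>K. finite K \<and> K \<subseteq> M \<and> M \<subseteq> (\<Union>x\<in>K. mball x (1 / Suc n))"
    unfolding mtotally_bounded_def by (metis of_nat_0_less_iff zero_less_Suc zero_less_divide_1_iff)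
  then obtain K where K: "\<And>n. finite (K n)" "\<And>n. M \<subseteq> (\<Union>x\<in>K n. mball x (1 / Suc n))"
    by metis
  define D where "D = (\<Union>n. K n)"
  have cD: "countable D" unfolding D_def using K(1) by (auto intro: countable_finite)
  define G where "G x = {prod_encode (m, to_nat_on D s) |m s. s \<in> D \<and> x \<in> mball s (1 / Suc m)}" for x
  have "inj_on G M"
  proof (rule inj_onI, rule ccontr)
    fix x y assume x: "x \<in> M" and y: "y \<in> M" and eq: "G x = G y" and "x \<noteq> y"
    then have "d x y / 2 > 0" by simp
    then obtain n :: nat where n: "1 / Suc n < d x y / 2"
      using nat_approx_posE by blast
    obtain s where s: "s \<in> K n" "x \<in> mball s (1 / Suc n)" using K(2)[of n] x by auto
    then have "prod_encode (n, to_nat_on D s) \<in> G x" by (auto simp: G_def D_def)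
    then have "prod_encode (n, to_nat_on D s) \<in> G y" using eq by simp
    then obtain t where "t \<in> D" "to_nat_on D t = to_nat_on D s" "y \<in> mball t (1 / Suc n)"
      by (auto simp: G_def)
    moreover have "s \<in> D" using s by (auto simp: D_def)
    ultimately have "y \<in> mball s (1 / Suc n)" using cD by simp
    then have "d s y < 1 / Suc n" "d s x < 1 / Suc n" "s \<in> M" using s by auto
    then show False using triangle[of x s y] n x y commute[of x s] by simp
  qed
  moreover obtain h :: "nat set \<Rightarrow> real" where "inj h"
    using nat_sets_eqpoll_reals by (auto simp: eqpoll_def bij_betw_def)
  ultimately have "inj_on (h \<circ> G) M" by (auto intro: comp_inj_on inj_on_subset)
  then show thesis by (rule that)
qed

lemma meager_in_homeomorphic_image:
  fixes T :: "'a topology" and T' :: "'b topology"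
  assumes h: "homeomorphic_map T T' h" and A: "meager_in T A"
  shows "meager_in T' (h ` A)"
proof -
  obtain F :: "nat \<Rightarrow> 'a set"
    where "(\<forall>n. nowhere_dense_in T (F n)) \<and> A = (\<Union>n. F n)"
    using A unfolding meager_in_def ..
  then have F: "\<And>n. nowhere_dense_in T (F n)" "A = (\<Union>n. F n)" by simp_all
  have "nowhere_dense_in T' (h ` F n)" for n
  proof -
    have sub: "F n \<subseteq> topspace T" and int: "T interior_of (T closure_of F n) = {}"
      using F(1)[of n] by (auto simp: nowhere_dense_in_def)
    have "T' interior_of (T' closure_of h ` F n) = h ` (T interior_of (T closure_of F n))"
      using homeomorphic_map_closure_of[OF h sub]
        homeomorphic_map_interior_of[OF h closure_of_subset_topspace[of T "F n"]] by simp
    moreover have "h ` F n \<subseteq> topspace T'"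
      using sub homeomorphic_imp_surjective_map[OF h] by blast
    ultimately show ?thesis
      using int by (simp add: nowhere_dense_in_def)
  qed
  then have "(\<forall>n. nowhere_dense_in T' (h ` F n)) \<and> h ` A = (\<Union>n. h ` F n)"
    by (simp add: F(2) image_UN)
  then show ?thesis
    unfolding meager_in_def by (rule exI[of _ "\<lambda>n. h ` F n"])
qed

lemma haar_meagerI:
  fixes K :: "'k metric" and T :: "'a::ab_group_add topology"
  assumes B: "B \<in> sets (borel_of T)" "A \<subseteq> B"
    and K: "compact_space (mtopology_of K)" "mspace K \<noteq> {}"
    and f: "continuous_map (mtopology_of K) T f"
    and meager: "\<And>x. x \<in> topspace T \<Longrightarrow>
      meager_in (mtopology_of K) {k \<in> mspace K. f k \<in> (\<lambda>b. b + x) ` B}"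
  shows "haar_meager T A"
proof -
  interpret K: Metric_space "mspace K" "mdist K" by simp
  obtain g :: "'k \<Rightarrow> real" where g: "inj_on g (mspace K)"
    using K.compact_imp_inj_real K(1) by (auto simp: mtopology_of_def)
  define h where "h = (\<lambda>r. if r \<in> g ` mspace K then the_inv_into (mspace K) g r
                           else (SOME k. k \<in> mspace K))"
  have hg: "h (g k) = k" if "k \<in> mspace K" for k
    using that g by (simp add: h_def the_inv_into_f_f)
  have hin: "h r \<in> mspace K" for r
    using K(2) g by (auto simp: h_def the_inv_into_f_f some_in_eq)
  interpret R: Metric_space "g ` mspace K" "\<lambda>r s. mdist K (h r) (h s)"
    by standard (use hg hin in \<open>auto simp: mdist_commute intro: mdist_triangle\<close>)
  define K' where "K' = metric (g ` mspace K, \<lambda>r s. mdist K (h r) (h s))"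
  have K': "mspace K' = g ` mspace K" "mtopology_of K' = R.mtopology"
    by (simp_all add: K'_def)
  have cg: "continuous_map (mtopology_of K) (mtopology_of K') g"
    unfolding K'(2) unfolding mtopology_of_def
    by (subst K.metric_continuous_map[OF R.Metric_space_axioms]) (auto simp: hg)
  have ch: "continuous_map (mtopology_of K') (mtopology_of K) h"
    unfolding K'(2) unfolding mtopology_of_def
    by (subst R.metric_continuous_map[OF K.Metric_space_axioms]) (auto simp: hg)
  have "homeomorphic_maps (mtopology_of K) (mtopology_of K') g h"
    unfolding homeomorphic_maps_def using cg ch hg by (auto simp: K')
  then have hom: "homeomorphic_map (mtopology_of K) (mtopology_of K') g"
    using homeomorphic_map_maps by blast
  have "compact_space (mtopology_of K')"
    using K(1) hom homeomorphic_compact_space homeomorphic_map_imp_homeomorphic_space by blast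
  moreover have "continuous_map (mtopology_of K') T (f \<circ> h)"
    using ch f by (rule continuous_map_compose)
  moreover have "meager_in (mtopology_of K') {k \<in> mspace K'. (f \<circ> h) k \<in> (\<lambda>b. b + x) ` B}"
    if "x \<in> topspace T" for x
  proof -
    have "{k \<in> mspace K'. (f \<circ> h) k \<in> (\<lambda>b. b + x) ` B} = g ` {k \<in> mspace K. f k \<in> (\<lambda>b. b + x) ` B}"
      by (auto simp: K' hg)
    then show ?thesis using meager_in_homeomorphic_image[OF hom meager[OF that]] by simp
  qed
  ultimately show ?thesis
    unfolding haar_meager_def using B K(2)
    by (intro bexI[of _ B] conjI exI[of _ K'] exI[of _ "f \<circ> h"]) (auto simp: K')
qed

end

theory Submission
  imports Defs
begin

text \<open>
  The first coordinate alone makes the set small in the sense of category, and large in the sense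
  of measure.

  Smallness: a translate of \<open>B \<times> A\<close> meets a line in the direction of the first coordinate in a
  subset of a translate of \<open>B\<close>, which is meager.  So a segment of that line witnesses that the product is
  Haar meager (\<open>haar_meager_product\<close>).  It is meager since cylinders over closed nowhere
  dense sets of reals are closed and nowhere dense (\<open>meager_product\<close>).

  Largeness: let \<open>\<mu>\<close> be a Borel probability measure.  As the space is complete and separable, \<open>\<mu>\<close>
  charges a compact set \<open>K\<close> (\<open>tight_compactin\<close>).  The tails of the elements of \<open>K\<close> form a compact
  set, which a translation moves into \<open>A\<close>.  Relative to \<open>K\<close>, suitable translates of \<open>B \<times> A\<close> thus
  contain the full cylinders over the translates of \<open>B\<close>, and by Fubini one of these has positive
  measure, since \<open>B\<close> has positive Lebesgue measure (\<open>exists_translate_positive_measure\<close>).  Hence no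
  \<open>\<mu>\<close> can witness that the product is Haar null (\<open>not_haar_null_product\<close>).

  The argument uses only a few properties of the sequence spaces, collected in the locale
  \<open>polish_sequence_group\<close>.  What has to be checked for \<open>c\<^sub>0\<close>, \<open>c\<close> and \<open>l\<^sub>p\<close> is mainly completeness and
  separability.  Examples exist because a closed nowhere dense set of positive measure is a possible \<open>B\<close>, and the whole space a
  possible \<open>A\<close>.
\<close>

section \<open>Borel sets and continuous maps\<close>

lemma (in Metric_space) nonexpansive_imp_continuous_map:
  assumes "Metric_space M' d'" and "f \<in> M \<rightarrow> M'"
    and "\<And>x y. x \<in> M \<Longrightarrow> y \<in> M \<Longrightarrow> d' (f x) (f y) \<le> d x y"
  shows "continuous_map mtopology (Metric_space.mtopology M' d') f"
  unfolding metric_continuous_map[OF assms(1)]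
proof (intro conjI ballI allI impI)
  show "f ` M \<subseteq> M'" using assms(2) by blast
  fix a e assume "a \<in> M" "0 < (e::real)"
  then show "\<exists>\<delta>>0. \<forall>x. x \<in> M \<and> d a x < \<delta> \<longrightarrow> d' (f a) (f x) < e"
    using assms(3) by (intro exI[of _ e]) (auto intro: order_le_less_trans)
qed

lemma sets_borel_of_openin: "openin T U \<Longrightarrow> U \<in> sets (borel_of T)"
  by (auto simp: borel_of_def dest: openin_subset)

lemma space_borel_of [simp]: "space (borel_of T) = topspace T"
  unfolding borel_of_def by (rule space_measure_of) (auto dest: openin_subset)

lemma sets_borel_of_closedin:
  assumes "closedin T C" shows "C \<in> sets (borel_of T)"
proof -
  have "space (borel_of T) - (topspace T - C) \<in> sets (borel_of T)"
    using assms by (intro sets.compl_sets sets_borel_of_openin) auto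
  moreover have "topspace T - (topspace T - C) = C"
    using closedin_subset[OF assms] by auto
  ultimately show ?thesis by simp
qed

lemma borel_of_euclidean: "borel_of (euclidean :: 'a::topological_space topology) = borel"
  by (simp add: borel_of_def borel_def)

lemma continuous_map_measurable_borel_of:
  assumes "continuous_map T T' f"
  shows "f \<in> measurable (borel_of T) (borel_of T')"
  unfolding borel_of_def[of T']
proof (rule measurable_measure_of)
  show "f \<in> space (borel_of T) \<rightarrow> topspace T'"
    using assms by (auto simp: continuous_map_def)
  fix U assume "U \<in> {U. openin T' U}"
  then show "f -` U \<inter> space (borel_of T) \<in> sets (borel_of T)"
    using openin_continuous_map_preimage[OF assms, of U]
    by (intro sets_borel_of_openin) (simp add: vimage_def Int_def conj_commute)
qed (auto dest: openin_subset)

section \<open>Meager sets\<close>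

lemma meager_in_subset:
  assumes "meager_in T A" "B \<subseteq> A"
  shows "meager_in T B"
proof -
  obtain F where F: "\<And>n. nowhere_dense_in T (F n)" "A = (\<Union>n::nat. F n)"
    using assms(1) unfolding meager_in_def by auto
  have "nowhere_dense_in T (F n \<inter> B)" for n
    using F(1)[of n] interior_of_mono[OF closure_of_mono, of "F n \<inter> B" "F n" T T]
    unfolding nowhere_dense_in_def by auto
  moreover have "B = (\<Union>n. F n \<inter> B)" using F(2) assms(2) by auto
  ultimately show ?thesis unfolding meager_in_def by (intro exI[of _ "\<lambda>n. F n \<inter> B"]) blast
qed

lemma meager_in_UN_closedin:
  assumes "\<And>n::nat. closedin T (F n)" "\<And>n. T interior_of (F n) = {}" "A \<subseteq> (\<Union>n. F n)"
  shows "meager_in T A"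
proof (rule meager_in_subset[OF _ assms(3)])
  have "nowhere_dense_in T (F n)" for n
    using assms(1)[of n] assms(2)[of n] closedin_subset
    by (auto simp: nowhere_dense_in_def closure_of_closedin)
  then show "meager_in T (\<Union>n. F n)" unfolding meager_in_def by blast
qed

lemma meager_in_imp_closed_cover:
  assumes "meager_in T A"
  obtains F :: "nat \<Rightarrow> 'a set" where
    "\<And>n. closedin T (F n)" "\<And>n. T interior_of (F n) = {}" "A \<subseteq> (\<Union>n. F n)"
proof -
  obtain F where F: "\<And>n. nowhere_dense_in T (F n)" "A = (\<Union>n::nat. F n)"
    using assms unfolding meager_in_def by auto
  show thesis
  proof (rule that[of "\<lambda>n. T closure_of F n"])
    show "A \<subseteq> (\<Union>n. T closure_of F n)"
      using F(1) closure_of_subset unfolding F(2) nowhere_dense_in_def by fast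
  qed (use F(1) in \<open>auto simp: nowhere_dense_in_def\<close>)
qed

text \<open>
  The closed unit interval is the closure of its interior, so a nonempty relatively open subset of
  it contains a nonempty open set of reals.
\<close>

lemma interior_of_unit_interval_eq_empty:
  fixes C :: "real set"
  assumes "interior C = {}"
  shows "top_of_set {0..1} interior_of ({0..1} \<inter> C) = {}"
proof (rule ccontr)
  let ?W = "top_of_set {0..1} interior_of ({0..1} \<inter> C)"
  assume "?W \<noteq> {}"
  moreover obtain V where V: "open V" "?W = {0..1} \<inter> V"
    using openin_interior_of[of "top_of_set {0..1}" "{0..1} \<inter> C"] unfolding openin_open by blast
  moreover have "closure {0<..<1::real} = {0..1}" by simp
  ultimately have "{0<..<1} \<inter> V \<noteq> {}"
    using open_Int_closure_eq_empty[of V "{0<..<1}"] by blast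
  moreover have "{0<..<1} \<inter> V \<subseteq> C"
    using V(2) interior_of_subset[of "top_of_set {0..1}" "{0..1} \<inter> C"] by fastforce
  then have "{0<..<1} \<inter> V \<subseteq> interior C"
    using V(1) by (intro interior_maximal) auto
  ultimately show False using assms by blast
qed

text \<open>
  A set in the manner of a fat Cantor set: the unit interval without an open neighbourhood of the rationals of measure
  less than \<open>1\<close>.
\<close>

lemma meager_set_of_positive_measure:
  obtains B :: "real set" where
    "B \<in> sets lebesgue" "meager_in euclidean B" "emeasure lebesgue B > 0"
proof -
  have Q: "\<rat> \<in> null_sets (lebesgue :: real measure)"
    using countable_imp_null_set_lborel[OF countable_rat] null_sets_completionI by blast
  obtain U :: "real set" where U: "open U" "\<rat> \<subseteq> U" "U - \<rat> \<in> lmeasurable" "emeasure lebesgue (U - \<rat>) < ennreal 1"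
    using sets_lebesgue_outer_open[of "\<rat> :: real set" 1] Q by auto
  have U1: "emeasure lebesgue U < 1"
    using emeasure_Diff_null_set[OF Q, of U] U by (simp add: borel_open)
  define B where "B = {0..1} - U"
  have cl: "closed B" using U by (auto simp: B_def)
  have "interior B = {}"
  proof (rule ccontr)
    assume "interior B \<noteq> {}"
    then obtain x e where "e > 0" "ball x e \<subseteq> B"
      by (meson ex_in_conv mem_interior)
    moreover obtain r :: real where "r \<in> \<rat>" "x < r" "r < x + e"
      using Rats_dense_in_real[of x "x + e"] \<open>e > 0\<close> by auto
    ultimately have "r \<in> B" by (auto simp: dist_real_def subset_iff)
    then show False using \<open>r \<in> \<rat>\<close> U by (auto simp: B_def)
  qed
  then have "meager_in euclidean B"
    using cl meager_in_UN_closedin[of euclidean "\<lambda>_. B" B] by simp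
  moreover have "emeasure lebesgue B > 0"
  proof (rule ccontr)
    assume "\<not> emeasure lebesgue B > 0"
    then have "emeasure lebesgue B = 0" by (simp add: zero_less_iff_neq_zero)
    have "1 = emeasure lebesgue {0..1::real}" by simp
    also have "\<dots> \<le> emeasure lebesgue (B \<union> U)"
      using U cl by (intro emeasure_mono) (auto simp: B_def)
    also have "\<dots> \<le> emeasure lebesgue B + emeasure lebesgue U"
      using U cl by (intro emeasure_subadditive) auto
    finally show False using U1 \<open>emeasure lebesgue B = 0\<close> by simp
  qed
  moreover have "B \<in> sets lebesgue" using cl by (simp add: borel_closed)
  ultimately show thesis using that by blast
qed

section \<open>Translates of sets of positive measure\<close>

text \<open>
  By Fubini and the translation and reflection invariance of Lebesgue measure,
  \<open>\<nu> (B + s)\<close> has integral \<open>\<nu> UNIV * lborel B > 0\<close> over \<open>s\<close>, so it cannot vanish identically.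
  In other words, a set of positive measure in \<open>\<real>\<close> is not Haar null.
\<close>

lemma exists_translate_positive_measure:
  fixes \<nu> :: "real measure"
  assumes \<nu>: "finite_measure \<nu>" "sets \<nu> = sets borel" "emeasure \<nu> (space \<nu>) > 0"
    and B: "B \<in> sets borel" "emeasure lborel B > 0"
  obtains s where "emeasure \<nu> {u. u - s \<in> B} > 0"
proof -
  interpret \<nu>: finite_measure \<nu> by fact
  interpret P: pair_sigma_finite \<nu> "lborel :: real measure" ..
  note [measurable] = B(1)
  note [measurable_cong] = \<nu>(2)
  have "(\<integral>\<^sup>+ s. \<integral>\<^sup>+ u. indicator B (u - s) \<partial>\<nu> \<partial>lborel)
      = (\<integral>\<^sup>+ u. \<integral>\<^sup>+ s. indicator B (u - s) \<partial>lborel \<partial>\<nu>)"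
    by (rule P.Fubini') measurable
  also have "\<dots> = (\<integral>\<^sup>+ u. emeasure lborel B \<partial>\<nu>)"
  proof (rule nn_integral_cong)
    fix u :: real
    show "(\<integral>\<^sup>+ s. indicator B (u - s) \<partial>lborel) = emeasure lborel B"
      using nn_integral_real_affine[of "indicator B" "-1" u] B(1) by simp
  qed
  also have "\<dots> > 0" using \<nu>(3) B(2) by (simp add: ennreal_zero_less_mult_iff)
  finally have pos: "(\<integral>\<^sup>+ s. \<integral>\<^sup>+ u. indicator B (u - s) \<partial>\<nu> \<partial>lborel) > 0" .
  have "(\<integral>\<^sup>+ u. indicator B (u - s) \<partial>\<nu>) = emeasure \<nu> {u. u - s \<in> B}" for s
  proof -
    have "{u. u - s \<in> B} \<in> sets \<nu>" unfolding \<nu>(2) by measurable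
    moreover have "indicator B (u - s) = (indicator {u. u - s \<in> B} u :: ennreal)" for u
      by (simp add: indicator_def)
    ultimately show ?thesis by simp
  qed
  note marginal = this
  show thesis
  proof (rule ccontr)
    assume "\<not> thesis"
    then have "emeasure \<nu> {u. u - s \<in> B} = 0" for s
      using that[of s] by (auto simp: zero_less_iff_neq_zero)
    then show False using pos by (simp add: marginal)
  qed
qed

section \<open>Tightness of finite measures on complete separable metric spaces\<close>

text \<open>
  The centres of a cover may lie outside the set: a centre whose ball meets the set is replaced by a
  point of the set in that ball, at the price of a larger radius.
\<close>

lemma (in Metric_space) small_cover_imp_mtotally_bounded:
  assumes "S \<subseteq> M"
    and "\<And>e. e > 0 \<Longrightarrow> \<exists>F. finite F \<and> S \<subseteq> (\<Union>x\<in>F. mcball x e)"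
  shows "mtotally_bounded S"
  unfolding mtotally_bounded_def
proof (intro allI impI)
  fix e :: real assume e: "e > 0"
  then obtain F where F: "finite F" "S \<subseteq> (\<Union>x\<in>F. mcball x (e/3))"
    using assms(2)[of "e/3"] by auto
  define G where "G = {x\<in>F. S \<inter> mcball x (e/3) \<noteq> {}}"
  define c where "c x = (SOME s. s \<in> S \<inter> mcball x (e/3))" for x
  have c: "c x \<in> S \<inter> mcball x (e/3)" if "x \<in> G" for x
  proof -
    have "\<exists>s. s \<in> S \<inter> mcball x (e/3)" using that by (auto simp: G_def)
    then show ?thesis unfolding c_def by (rule someI_ex)
  qed
  show "\<exists>K. finite K \<and> K \<subseteq> S \<and> S \<subseteq> (\<Union>x\<in>K. mball x e)"
  proof (intro exI conjI)
    show "finite (c ` G)" using F by (simp add: G_def)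
    show "c ` G \<subseteq> S" using c by auto
    show "S \<subseteq> (\<Union>x\<in>c ` G. mball x e)"
    proof
      fix s assume s: "s \<in> S"
      then obtain x where x: "x \<in> F" "s \<in> mcball x (e/3)" using F by auto
      then have "x \<in> G" using s by (auto simp: G_def)
      from c[OF this] x(2)
      have cx: "c x \<in> M" "x \<in> M" "s \<in> M" "d x (c x) \<le> e/3" "d x s \<le> e/3" by auto
      then have "d (c x) s < e"
        using triangle[of "c x" x s] commute[of x "c x"] e by simp
      then have "s \<in> mball (c x) e" using cx by simp
      then show "s \<in> (\<Union>x\<in>c ` G. mball x e)" using \<open>x \<in> G\<close> by blast
    qed
  qed
qed

text \<open>
  Ulam's argument: for each radius, finitely many balls around points of the dense set carry all
  but a small share of the mass.  Intersecting these finite unions over radii tending to \<open>0\<close>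
  gives a closed and totally bounded set, hence, by completeness, a compact one.
\<close>

lemma (in Metric_space) tight_compactin:
  assumes complete: mcomplete
    and D: "countable D" "\<And>x e. x \<in> M \<Longrightarrow> e > 0 \<Longrightarrow> \<exists>y\<in>D. x \<in> mcball y e"
    and \<mu>: "finite_measure \<mu>" "sets \<mu> = sets (borel_of mtopology)" "emeasure \<mu> (space \<mu>) > 0"
  obtains K where "compactin mtopology K" "K \<in> sets \<mu>" "emeasure \<mu> K > 0"
proof -
  interpret \<mu>: finite_measure \<mu> by fact
  have sp: "space \<mu> = M"
    using sets_eq_imp_space_eq[OF \<mu>(2)] by simp
  have M0: "M \<noteq> {}" using \<mu>(3) sp by auto
  then have D0: "D \<noteq> {}" using D(2)[of _ 1] by auto
  define q where "q = from_nat_into D"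
  define C where "C n k = (\<Union>i\<le>k. mcball (q i) (1 / Suc n))" for n k :: nat
  have closed: "closedin mtopology (C n k)" for n k
    unfolding C_def by (intro closedin_Union) auto
  then have meas: "C n k \<in> sets \<mu>" for n k
    using \<mu>(2) sets_borel_of_closedin by blast
  define m where "m = measure \<mu> M"
  have m: "m > 0"
    using \<mu>(3) by (simp add: m_def sp \<mu>.emeasure_eq_measure)
  have "\<exists>k. measure \<mu> (M - C n k) < m / 2 ^ (n + 2)" for n
  proof -
    have "(\<Union>k. C n k) = M"
    proof
      show "M \<subseteq> (\<Union>k. C n k)"
      proof
        fix x assume "x \<in> M"
        then obtain y where "y \<in> D" "x \<in> mcball y (1 / Suc n)"
          using D(2)[of x "1 / Suc n"] by auto
        moreover obtain i where "q i = y"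
          using \<open>y \<in> D\<close> D(1) from_nat_into_surj q_def by metis
        ultimately show "x \<in> (\<Union>k. C n k)" unfolding C_def by blast
      qed
    qed (auto simp: C_def)
    moreover have "incseq (C n)" unfolding C_def by (intro monoI UN_mono) auto
    moreover have "range (C n) \<subseteq> sets \<mu>" using meas by blast
    ultimately have "(\<lambda>k. measure \<mu> (C n k)) \<longlonglongrightarrow> m"
      using \<mu>.finite_Lim_measure_incseq[of "C n"] by (simp add: m_def)
    then have "eventually (\<lambda>k. measure \<mu> (C n k) > m - m / 2 ^ (n + 2)) sequentially"
      using m by (intro order_tendstoD) auto
    then obtain k where "measure \<mu> (C n k) > m - m / 2 ^ (n + 2)"
      by (auto simp: eventually_sequentially)
    then have "measure \<mu> (M - C n k) < m / 2 ^ (n + 2)"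
      using \<mu>.finite_measure_compl[OF meas, of n k] by (simp add: sp m_def)
    then show ?thesis ..
  qed
  then obtain k where k: "\<And>n. measure \<mu> (M - C n (k n)) < m / 2 ^ (n + 2)" by metis
  \<comment> \<open>The errors \<open>m / 2 ^ (n + 2)\<close> sum to \<open>m / 2\<close>, so at least half of the mass survives.\<close>
  define K where "K = (\<Inter>n. C n (k n))"
  have KM: "K \<subseteq> M" by (auto simp: K_def C_def)
  have clK: "closedin mtopology K" unfolding K_def using closed by (intro closedin_Inter) auto
  have Kmeas: "K \<in> sets \<mu>" using clK \<mu>(2) sets_borel_of_closedin by blast
  have geo: "(\<lambda>n. m / 2 ^ (n + 2)) sums (m / 2)"
    using sums_mult[OF power_half_series, of "m/2"] by (simp add: field_simps)
  have sm: "summable (\<lambda>n. measure \<mu> (M - C n (k n)))"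
    using k by (intro summable_comparison_test'[OF sums_summable[OF geo], of 0]) (auto intro: less_imp_le)
  have "M - C n (k n) \<in> sets \<mu>" for n using sets.compl_sets[OF meas] by (simp add: sp)
  then have "measure \<mu> (\<Union>n. M - C n (k n)) \<le> (\<Sum>n. measure \<mu> (M - C n (k n)))"
    using sm by (intro \<mu>.finite_measure_subadditive_countably) blast+
  moreover have "M - K = (\<Union>n. M - C n (k n))" by (auto simp: K_def)
  ultimately have "measure \<mu> (M - K) \<le> (\<Sum>n. measure \<mu> (M - C n (k n)))" by simp
  also have "\<dots> \<le> m / 2"
    using suminf_le[OF less_imp_le[OF k] sm sums_summable[OF geo]] sums_unique[OF geo] by simp
  finally have "measure \<mu> K \<ge> m / 2"
    using \<mu>.finite_measure_compl[OF Kmeas] by (simp add: sp m_def)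
  then have "emeasure \<mu> K > 0" using m by (simp add: \<mu>.emeasure_eq_measure)
  moreover have "mtotally_bounded K"
  proof (rule small_cover_imp_mtotally_bounded[OF KM])
    fix e :: real assume "e > 0"
    then obtain n where n: "1 / Suc n < e" using nat_approx_posE by blast
    have "K \<subseteq> C n (k n)" by (auto simp: K_def)
    also have "\<dots> \<subseteq> (\<Union>x\<in>q ` {..k n}. mcball x e)"
      using mcball_subset_concentric[of "1 / Suc n" e] n unfolding C_def by fastforce
    finally show "\<exists>F. finite F \<and> K \<subseteq> (\<Union>x\<in>F. mcball x e)" by blast
  qed
  then have "compactin mtopology K"
    using mtotally_bounded_eq_compact_closure_of[OF complete] clK by (simp add: closure_of_closedin)
  ultimately show thesis using that Kmeas by blast
qed

section \<open>Sequences as pairs of a head and a tail\<close>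

definition tail :: "(nat \<Rightarrow> 'a) \<Rightarrow> nat \<Rightarrow> 'a" where
  "tail x = (\<lambda>n. x (Suc n))"

lemma prepend_0 [simp]: "prepend (t, x) 0 = t"
  and prepend_Suc [simp]: "prepend (t, x) (Suc n) = x n"
  and tail_prepend [simp]: "tail (prepend (t, x)) = x"
  and prepend_tail [simp]: "prepend (y 0, tail y) = y"
  by (auto simp: prepend_def tail_def fun_eq_iff split: nat.split)

lemma prepend_diff: "prepend (s, x) - prepend (t, y) = prepend (s - t, x - y)"
  by (auto simp: prepend_def fun_eq_iff split: nat.split)

lemma tail_diff: "tail (x - y) = tail x - tail (y :: nat \<Rightarrow> real)"
  by (simp add: tail_def fun_eq_iff)

lemma tail_funpow: "(tail ^^ m) x = (\<lambda>n. x (n + m))"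
  by (induction m) (auto simp: tail_def)

section \<open>Polish groups of sequences\<close>

text \<open>
  What the proof needs to know about \<open>c\<^sub>0\<close>, \<open>c\<close> and \<open>l\<^sub>p\<close>.  The two assumptions on \<open>prepend\<close>,
  together with those on \<open>tail\<close> and on the first coordinate, make the identification of
  \<open>\<real> \<times> M\<close> with \<open>M\<close> a homeomorphism.  Separability enters through the countable set \<open>Z\<close> of model
  tails: every element of \<open>M\<close> looks, from some index on, almost like an element of \<open>Z\<close>.  For \<open>c\<^sub>0\<close>
  and \<open>l\<^sub>p\<close> the zero sequence is the only model tail, for \<open>c\<close> the rational constants serve.
\<close>

locale polish_sequence_group = Metric_space M "\<lambda>x y. N (x - y)"
  for M :: "(nat \<Rightarrow> real) set" and N :: "(nat \<Rightarrow> real) \<Rightarrow> real" +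
  fixes Z :: "(nat \<Rightarrow> real) set"
  assumes diff_mem: "x \<in> M \<Longrightarrow> y \<in> M \<Longrightarrow> x - y \<in> M"
    and prepend_mem_iff: "prepend (t, x) \<in> M \<longleftrightarrow> x \<in> M"
    and norm_prepend: "x \<in> M \<Longrightarrow> N (prepend (t, x)) \<le> \<bar>t\<bar> + N x"
    and norm_head: "x \<in> M \<Longrightarrow> \<bar>x 0\<bar> \<le> N x"
    and norm_tail: "x \<in> M \<Longrightarrow> N (tail x) \<le> N x"
    and complete: mcomplete
    and Z: "countable Z" "Z \<subseteq> M" "Z \<noteq> {}"
    and tails: "x \<in> M \<Longrightarrow> e > 0 \<Longrightarrow> \<exists>m. \<exists>z\<in>Z. N ((tail ^^ m) x - z) < e"
begin

lemma zero_mem: "0 \<in> M"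
  using diff_mem[of "SOME z. z \<in> Z" "SOME z. z \<in> Z"] Z(2,3) by (simp add: some_in_eq subset_iff)

lemma uminus_mem: "x \<in> M \<Longrightarrow> - x \<in> M"
  using diff_mem[OF zero_mem] by simp

lemma add_mem: "x \<in> M \<Longrightarrow> y \<in> M \<Longrightarrow> x + y \<in> M"
  using diff_mem[of x "- y"] uminus_mem by simp

lemma norm_zero: "N 0 = 0"
  using mdist_zero[OF zero_mem] by simp

lemma norm_prepend_zero: "N (prepend (t, 0)) \<le> \<bar>t\<bar>"
  using norm_prepend[OF zero_mem, of t] norm_zero by simp

lemma tail_mem: "x \<in> M \<Longrightarrow> tail x \<in> M"
  using prepend_mem_iff[of "x 0" "tail x"] by simp

text \<open>
  A dense set is formed by the elements of \<open>Z\<close> with finitely many rational numbers prepended.  As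
  \<open>prepend\<close> adds at most the size of the new coordinate to the distance, an approximation of a
  tail extends to one of the whole sequence, one coordinate at a time.
\<close>

lemma countable_dense:
  obtains D where "countable D" "\<And>x e. x \<in> M \<Longrightarrow> e > 0 \<Longrightarrow> \<exists>y\<in>D. x \<in> mcball y e"
proof -
  define ext where "ext rs z = foldr (\<lambda>r y. prepend (real_of_rat r, y)) rs z" for rs z
  have ext_mem: "ext rs z \<in> M" if "z \<in> M" for rs z
    using that by (induction rs) (auto simp: ext_def prepend_mem_iff)
  have approx: "\<exists>rs. N (x - ext rs z) < e"
    if "z \<in> M" "x \<in> M" "N ((tail ^^ m) x - z) < e" for m x z e
    using that(2,3)
  proof (induction m arbitrary: x)
    case 0
    then show ?case by (intro exI[of _ "[]"]) (simp add: ext_def)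
  next
    case (Suc m)
    have "N ((tail ^^ m) (tail x) - z) < e"
      using Suc.prems(2) unfolding funpow_Suc_right o_apply .
    then obtain rs where rs: "N (tail x - ext rs z) < e"
      using Suc.IH[OF tail_mem[OF Suc.prems(1)]] by blast
    obtain q where q: "q \<in> \<rat>" "x 0 - (e - N (tail x - ext rs z)) < q" "q < x 0"
      using Rats_dense_in_real[of "x 0 - (e - N (tail x - ext rs z))" "x 0"] rs by auto
    then obtain r where r: "q = real_of_rat r" by (auto elim: Rats_cases)
    have "x - ext (r # rs) z = prepend (x 0 - q, tail x - ext rs z)"
      using prepend_diff[of "x 0" "tail x" q "ext rs z"] by (simp add: ext_def r)
    then have "N (x - ext (r # rs) z) \<le> \<bar>x 0 - q\<bar> + N (tail x - ext rs z)"
      using norm_prepend diff_mem tail_mem ext_mem Suc.prems(1) that(1) by simp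
    also have "\<dots> < e" using q by simp
    finally show ?case by blast
  qed
  show thesis
  proof
    show "countable ((\<lambda>(rs, z). ext rs z) ` (UNIV \<times> Z))"
      using Z(1) by simp
    fix x e assume x: "x \<in> M" and e: "e > (0::real)"
    obtain m z where z: "z \<in> Z" "N ((tail ^^ m) x - z) < e" using tails[OF x e] by blast
    then obtain rs where "N (x - ext rs z) < e" using approx x Z(2) by blast
    then have "x \<in> mcball (ext rs z) e"
      using x z ext_mem Z(2) commute[of x "ext rs z"] by auto
    then show "\<exists>y\<in>(\<lambda>(rs, z). ext rs z) ` (UNIV \<times> Z). x \<in> mcball y e"
      using z(1) by blast
  qed
qed

lemma continuous_map_tail: "continuous_map mtopology mtopology tail"
  using tail_mem norm_tail diff_mem
  by (intro nonexpansive_imp_continuous_map Metric_space_axioms) (auto simp flip: tail_diff)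

lemma continuous_map_head: "continuous_map mtopology euclideanreal (\<lambda>x. x 0)"
proof -
  have "continuous_map mtopology (Metric_space.mtopology UNIV dist) (\<lambda>x. x 0)"
    using norm_head[OF diff_mem]
    by (intro nonexpansive_imp_continuous_map) (auto simp: dist_real_def Met_TC.Metric_space_axioms)
  then show ?thesis by simp
qed

lemma continuous_map_minus_const:
  assumes "x \<in> M" shows "continuous_map mtopology mtopology (\<lambda>y. y - x)"
  using assms diff_mem
  by (intro nonexpansive_imp_continuous_map Metric_space_axioms) auto

lemma continuous_map_prepend_zero:
  "continuous_map euclideanreal mtopology (\<lambda>t. prepend (t, 0))"
proof -
  have "continuous_map Met_TC.mtopology mtopology (\<lambda>t::real. prepend (t, 0))"
    using norm_prepend_zero zero_mem
    by (intro Met_TC.nonexpansive_imp_continuous_map Metric_space_axioms)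
       (auto simp: dist_real_def prepend_diff prepend_mem_iff)
  then show ?thesis by simp
qed

lemma sets_translate:
  assumes "x \<in> M" "B \<in> sets (borel_of mtopology)"
  shows "(\<lambda>b. x + b) ` B \<in> sets (borel_of mtopology)"
proof -
  have "B \<subseteq> M" using sets.sets_into_space[OF assms(2)] by simp
  have "(\<lambda>b. x + b) ` B = (\<lambda>y. y - x) -` B \<inter> M"
  proof (intro equalityI subsetI)
    fix y assume "y \<in> (\<lambda>y. y - x) -` B \<inter> M"
    then show "y \<in> (\<lambda>b. x + b) ` B" by (intro image_eqI[of _ _ "y - x"]) auto
  qed (use \<open>B \<subseteq> M\<close> assms(1) add_mem in auto)
  also have "\<dots> \<in> sets (borel_of mtopology)"
    using measurable_sets[OF continuous_map_measurable_borel_of[OF continuous_map_minus_const] assms(2)]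
      assms(1) by simp
  finally show ?thesis .
qed

lemma sets_product:
  assumes "B \<in> sets borel" "A \<in> sets (borel_of mtopology)"
  shows "{x \<in> M. x 0 \<in> B \<and> tail x \<in> A} \<in> sets (borel_of mtopology)"
proof -
  have "(\<lambda>x. x 0) -` B \<inter> M \<in> sets (borel_of mtopology)"
    using measurable_sets[OF continuous_map_measurable_borel_of[OF continuous_map_head]] assms(1)
    by (simp add: borel_of_euclidean)
  moreover have "tail -` A \<inter> M \<in> sets (borel_of mtopology)"
    using measurable_sets[OF continuous_map_measurable_borel_of[OF continuous_map_tail] assms(2)]
    by simp
  ultimately have "((\<lambda>x. x 0) -` B \<inter> M) \<inter> (tail -` A \<inter> M) \<in> sets (borel_of mtopology)"
    by (rule sets.Int)
  also have "((\<lambda>x. x 0) -` B \<inter> M) \<inter> (tail -` A \<inter> M) = {x \<in> M. x 0 \<in> B \<and> tail x \<in> A}"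
    by auto
  finally show ?thesis .
qed

text \<open>
  The witness is the unit segment in the direction of the first coordinate.  A translate of the
  product meets it in a subset of a translate of \<open>B\<close>, whatever \<open>A\<close> is.  To have a Borel superset,
  \<open>B\<close> is first enlarged to a countable union of closed nowhere dense sets.
\<close>

lemma haar_meager_product:
  assumes B: "meager_in euclidean B" and A: "A \<in> sets (borel_of mtopology)"
  shows "haar_meager mtopology (prepend ` (B \<times> A))"
proof -
  obtain F :: "nat \<Rightarrow> real set" where F: "\<And>n. closed (F n)" "\<And>n. interior (F n) = {}" "B \<subseteq> (\<Union>n. F n)"
    using meager_in_imp_closed_cover[OF B] by (auto simp flip: closed_closedin)
  define S where "S = {x \<in> M. x 0 \<in> (\<Union>n. F n) \<and> tail x \<in> A}"
  have AM: "A \<subseteq> M" using sets.sets_into_space[OF A] by simp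
  let ?I = "submetric euclidean_metric {0..1::real}"
  have I: "mspace ?I = {0..1}" "mtopology_of ?I = top_of_set {0..1}"
    by (simp_all add: mtopology_of_submetric)
  show ?thesis
  proof (rule haar_meagerI[of S _ _ ?I "\<lambda>t. prepend (t, 0)"])
    show "S \<in> sets (borel_of mtopology)"
      unfolding S_def using F(1) by (intro sets_product A sets.countable_UN) auto
    show "prepend ` (B \<times> A) \<subseteq> S"
      using F(3) AM by (fastforce simp: S_def prepend_mem_iff)
    show "compact_space (mtopology_of ?I)" "mspace ?I \<noteq> {}"
      by (simp_all add: I compact_space_subtopology)
    show "continuous_map (mtopology_of ?I) mtopology (\<lambda>t. prepend (t, 0))"
      unfolding I by (intro continuous_map_from_subtopology continuous_map_prepend_zero)
    fix x assume "x \<in> topspace mtopology"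
    let ?G = "\<lambda>n. {0..1} \<inter> (\<lambda>t. x 0 + t) ` F n"
    show "meager_in (mtopology_of ?I) {k \<in> mspace ?I. prepend (k, 0) \<in> (\<lambda>b. b + x) ` S}"
      unfolding I
    proof (rule meager_in_UN_closedin[of _ ?G])
      show "closedin (top_of_set {0..1}) (?G n)" for n
        using F(1) by (intro closedin_closed_Int closed_translation)
      show "top_of_set {0..1} interior_of ?G n = {}" for n
        using F(2) by (intro interior_of_unit_interval_eq_empty) (simp add: interior_translation)
      have "k \<in> (\<Union>n. (\<lambda>t. x 0 + t) ` F n)" if "prepend (k, 0) = b + x" "b \<in> S" for k b
      proof -
        have "k = x 0 + b 0" using fun_cong[OF that(1), of 0] by simp
        then show ?thesis using that(2) by (auto simp: S_def)
      qed
      then show "{k \<in> {0..1}. prepend (k, 0) \<in> (\<lambda>b. b + x) ` S} \<subseteq> (\<Union>n. ?G n)"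
        by blast
    qed
  qed
qed

text \<open>
  Moving only the first coordinate changes a sequence continuously, so a cylinder over a closed
  set without interior has no interior either.
\<close>

lemma meager_product:
  assumes B: "meager_in euclidean B" and A: "A \<subseteq> M"
  shows "meager_in mtopology (prepend ` (B \<times> A))"
proof -
  obtain F :: "nat \<Rightarrow> real set" where F: "\<And>n. closed (F n)" "\<And>n. interior (F n) = {}" "B \<subseteq> (\<Union>n. F n)"
    using meager_in_imp_closed_cover[OF B] by (auto simp flip: closed_closedin)
  show ?thesis
  proof (rule meager_in_UN_closedin)
    show "closedin mtopology {x \<in> M. x 0 \<in> F n}" for n
      using closedin_continuous_map_preimage[OF continuous_map_head, of "F n"] F(1) by simp
    show "mtopology interior_of {x \<in> M. x 0 \<in> F n} = {}" for n
    proof (rule ccontr)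
      assume "mtopology interior_of {x \<in> M. x 0 \<in> F n} \<noteq> {}"
      then obtain x e where x: "x \<in> M" "e > 0" "mball x e \<subseteq> {x \<in> M. x 0 \<in> F n}"
        unfolding metric_interior_of by blast
      have "ball (x 0) e \<subseteq> F n"
      proof
        fix t assume t: "t \<in> ball (x 0) e"
        define y where "y = prepend (t, tail x)"
        have "x - y = prepend (x 0 - t, 0)"
          using prepend_diff[of "x 0" "tail x" t "tail x"] by (simp add: y_def)
        then have "N (x - y) \<le> \<bar>x 0 - t\<bar>" using norm_prepend_zero by simp
        then have "y \<in> mball x e"
          using t x(1) tail_mem by (auto simp: y_def prepend_mem_iff dist_real_def)
        then have "y 0 \<in> F n" using x(3) by blast
        then show "t \<in> F n" by (simp add: y_def)
      qed
      then show False using F(2)[of n] x(2) mem_interior by blast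
    qed
    show "prepend ` (B \<times> A) \<subseteq> (\<Union>n. {x \<in> M. x 0 \<in> F n})"
      using F(3) A by (fastforce simp: prepend_mem_iff)
  qed
qed

text \<open>
  Given a candidate \<open>\<mu>\<close>, tightness yields a compact set \<open>K\<close> with \<open>\<mu> K > 0\<close>.  The tails of points
  of \<open>K\<close> form a compact set, so some translate of them lies in \<open>A\<close>; after this translation the
  second factor imposes no condition on points of \<open>K\<close>.  What remains is the marginal \<open>\<nu>\<close> of \<open>\<mu>\<close>
  restricted to \<open>K\<close> on the first coordinate, and some translate of \<open>B\<close> is not null for it.
\<close>

lemma not_haar_null_product:
  assumes A: "A \<in> catches_compacts mtopology"
    and B: "B \<in> sets lebesgue" "emeasure lebesgue B > 0"
  shows "\<not> haar_null mtopology (prepend ` (B \<times> A))"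
proof
  assume "haar_null mtopology (prepend ` (B \<times> A))"
  then obtain \<mu> S where \<mu>: "prob_space \<mu>" "sets \<mu> = sets (borel_of mtopology)"
    and S: "S \<in> sets (borel_of mtopology)" "prepend ` (B \<times> A) \<subseteq> S"
    and null: "\<And>x. x \<in> M \<Longrightarrow> emeasure \<mu> ((\<lambda>b. x + b) ` S) = 0"
    unfolding haar_null_def by auto
  interpret \<mu>: prob_space \<mu> by fact
  have space: "space \<mu> = M" using sets_eq_imp_space_eq[OF \<mu>(2)] by simp
  obtain D where D: "countable D" "\<And>x e. x \<in> M \<Longrightarrow> e > 0 \<Longrightarrow> \<exists>y\<in>D. x \<in> mcball y e"
    using countable_dense by blast
  obtain K where K: "compactin mtopology K" "K \<in> sets \<mu>" "emeasure \<mu> K > 0"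
    using tight_compactin[OF complete D \<mu>.finite_measure_axioms \<mu>(2)] \<mu>.emeasure_space_1 by auto
  have KM: "K \<subseteq> M" using compactin_subset_topspace[OF K(1)] by simp
  have "compactin mtopology (tail ` K)"
    by (rule image_compactin[OF K(1) continuous_map_tail])
  then obtain y where y: "y \<in> M" "(\<lambda>k. k + y) ` tail ` K \<subseteq> A"
    using A unfolding catches_compacts_def by auto
  define \<nu> where "\<nu> = distr (density \<mu> (indicator K)) borel (\<lambda>x. x 0)"
  have head [measurable]: "(\<lambda>x. x 0) \<in> measurable \<mu> borel"
    using continuous_map_measurable_borel_of[OF continuous_map_head]
    by (simp add: borel_of_euclidean measurable_cong_sets[OF \<mu>(2) refl])
  have \<nu>: "emeasure \<nu> E = emeasure \<mu> {x \<in> K. x 0 \<in> E}" if "E \<in> sets borel" for E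
  proof -
    have m: "(\<lambda>x. x 0) -` E \<inter> M \<in> sets \<mu>" using measurable_sets[OF head that] space by simp
    have "emeasure \<nu> E = emeasure (density \<mu> (indicator K)) ((\<lambda>x. x 0) -` E \<inter> M)"
      unfolding \<nu>_def using that by (subst emeasure_distr) (auto simp: space)
    also have "\<dots> = emeasure \<mu> (K \<inter> ((\<lambda>x. x 0) -` E \<inter> M))"
      using emeasure_restricted[OF K(2) m] .
    also have "K \<inter> ((\<lambda>x. x 0) -` E \<inter> M) = {x \<in> K. x 0 \<in> E}" using KM by auto
    finally show ?thesis .
  qed
  have "finite_measure \<nu>" "sets \<nu> = sets borel" "emeasure \<nu> (space \<nu>) > 0"
    using \<nu>[of UNIV] K(3) by (auto intro!: finite_measureI simp: \<nu>_def)
  \<comment> \<open>Being only Lebesgue measurable, \<open>B\<close> is replaced by a Borel subset of the same measure.\<close>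
  moreover have "main_part lborel B \<in> sets borel" "emeasure lborel (main_part lborel B) > 0"
    using B main_part_sets[of B lborel] by auto
  ultimately obtain s where s: "emeasure \<nu> {u. u - s \<in> main_part lborel B} > 0"
    using exists_translate_positive_measure by metis
  have "main_part lborel B \<subseteq> B" using main_part_null_part_Un[of B lborel] B(1) by blast
  define x where "x = prepend (s, - y)"
  have x: "x \<in> M" using y(1) uminus_mem by (simp add: x_def prepend_mem_iff)
  have "{z \<in> K. z 0 \<in> {u. u - s \<in> main_part lborel B}} \<subseteq> (\<lambda>b. x + b) ` S"
  proof
    fix z assume z: "z \<in> {z \<in> K. z 0 \<in> {u. u - s \<in> main_part lborel B}}"
    have "z - x = prepend (z 0 - s, tail z + y)"
      using prepend_diff[of "z 0" "tail z" s "- y"] by (simp add: x_def)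
    moreover have "z 0 - s \<in> B" "tail z + y \<in> A"
      using z y(2) \<open>main_part lborel B \<subseteq> B\<close> by auto
    ultimately have "z - x \<in> S" using S(2) by auto
    then show "z \<in> (\<lambda>b. x + b) ` S" by (intro image_eqI[of _ _ "z - x"]) auto
  qed
  then have "emeasure \<mu> {z \<in> K. z 0 \<in> {u. u - s \<in> main_part lborel B}} \<le> emeasure \<mu> ((\<lambda>b. x + b) ` S)"
    using sets_translate[OF x S(1)] \<mu>(2) by (intro emeasure_mono) auto
  moreover have "{u. u - s \<in> main_part lborel B} \<in> sets borel"
    using \<open>main_part lborel B \<in> sets borel\<close> by measurable
  ultimately show False using s null[OF x] by (simp add: \<nu>)
qed

text \<open>
  For the existence claim the whole space serves as \<open>A\<close>: it contains every compact set without
  any translation.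
\<close>

lemma haar_meager_not_haar_null:
  "(\<forall>A B S. A \<in> sets (borel_of mtopology) \<inter> catches_compacts mtopology \<longrightarrow>
            B \<in> sets lebesgue \<longrightarrow> meager_in euclidean B \<longrightarrow> emeasure lebesgue B > 0 \<longrightarrow>
            S = prepend ` (B \<times> A) \<longrightarrow>
            haar_meager mtopology S \<and> meager_in mtopology S \<and> \<not> haar_null mtopology S) \<and>
   (\<exists>S \<subseteq> topspace mtopology.
            haar_meager mtopology S \<and> meager_in mtopology S \<and> \<not> haar_null mtopology S)"
  (is "?products \<and> ?exists")
proof
  show prod: ?products
    using haar_meager_product meager_product not_haar_null_product
    by (auto simp: catches_compacts_def)
  obtain B :: "real set" where B:
    "B \<in> sets lebesgue" "meager_in euclidean B" "emeasure lebesgue B > 0"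
    using meager_set_of_positive_measure by blast
  have "M \<in> sets (borel_of mtopology)" using sets.top[of "borel_of mtopology"] by simp
  moreover have "M \<in> catches_compacts mtopology"
    unfolding catches_compacts_def
    using zero_mem compactin_subset_topspace by (fastforce intro!: bexI[of _ 0])
  moreover have "prepend ` (B \<times> M) \<subseteq> topspace mtopology" by (auto simp: prepend_mem_iff)
  ultimately show ?exists using prod B by blast
qed

end

section \<open>Completeness and coordinatewise limits\<close>

context Metric_space begin

lemma mcompleteI:
  assumes "\<And>\<sigma> :: nat \<Rightarrow> 'a. range \<sigma> \<subseteq> M \<Longrightarrow> (\<And>e. e > 0 \<Longrightarrow> \<exists>k. \<forall>m\<ge>k. \<forall>n\<ge>k. d (\<sigma> m) (\<sigma> n) \<le> e) \<Longrightarrow>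
    \<exists>l\<in>M. \<forall>e>0. \<exists>k. \<forall>n\<ge>k. d (\<sigma> n) l \<le> e"
  shows mcomplete
  unfolding mcomplete_def
proof (intro allI impI)
  fix \<sigma> :: "nat \<Rightarrow> 'a"
  assume \<sigma>: "MCauchy \<sigma>"
  have range: "range \<sigma> \<subseteq> M" using \<sigma> by (simp add: MCauchy_def)
  have "\<exists>k. \<forall>m\<ge>k. \<forall>n\<ge>k. d (\<sigma> m) (\<sigma> n) \<le> e" if "e > 0" for e
    using \<sigma> that unfolding MCauchy_def by (meson less_imp_le)
  with assms[OF range] obtain l where l: "l \<in> M" "\<And>e. e > 0 \<Longrightarrow> \<exists>k. \<forall>n\<ge>k. d (\<sigma> n) l \<le> e"
    by blast
  have "limitin mtopology \<sigma> l sequentially"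
    unfolding limit_metric_sequentially
  proof (intro conjI allI impI)
    fix e :: real assume "e > 0"
    then obtain k where "\<forall>n\<ge>k. d (\<sigma> n) l \<le> e / 2" using l(2)[of "e/2"] by auto
    then show "\<exists>k. \<forall>n\<ge>k. \<sigma> n \<in> M \<and> d (\<sigma> n) l < e"
      using range \<open>e > 0\<close> by (intro exI[of _ k]) fastforce
  qed (rule l(1))
  then show "\<exists>l. limitin mtopology \<sigma> l sequentially" ..
qed

end

lemma coordinates_converge:
  fixes \<sigma> :: "nat \<Rightarrow> nat \<Rightarrow> real"
  assumes "\<And>x y n. x \<in> M \<Longrightarrow> y \<in> M \<Longrightarrow> \<bar>x n - y n\<bar> \<le> N (x - y)"
    and "range \<sigma> \<subseteq> M" and "\<And>e. e > 0 \<Longrightarrow> \<exists>k. \<forall>m\<ge>k. \<forall>n\<ge>k. N (\<sigma> m - \<sigma> n) \<le> e"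
  obtains l where "\<And>i. (\<lambda>n. \<sigma> n i) \<longlonglongrightarrow> l i"
proof -
  have "convergent (\<lambda>n. \<sigma> n i)" for i
  proof (rule Cauchy_convergent, rule CauchyI)
    fix e :: real assume "e > 0"
    then obtain k where k: "\<And>m n. m \<ge> k \<Longrightarrow> n \<ge> k \<Longrightarrow> N (\<sigma> m - \<sigma> n) \<le> e / 2"
      using assms(3)[of "e/2"] by auto
    have "norm (\<sigma> m i - \<sigma> n i) < e" if "m \<ge> k" "n \<ge> k" for m n
      using assms(1)[of "\<sigma> m" "\<sigma> n" i] assms(2) k[OF that] \<open>e > 0\<close> by force
    then show "\<exists>k. \<forall>m\<ge>k. \<forall>n\<ge>k. norm (\<sigma> m i - \<sigma> n i) < e" by blast
  qed
  then show thesis using that unfolding convergent_def by metis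
qed

section \<open>The spaces \<open>c\<^sub>0\<close> and \<open>c\<close>\<close>

lemma convergent_imp_bounded_range:
  fixes x :: "nat \<Rightarrow> real"
  shows "convergent x \<Longrightarrow> bounded (range x)"
  using convergent_imp_Bseq Bseq_eq_bounded by blast

text \<open>
  The part common to \<open>c\<^sub>0\<close> and \<open>c\<close>.  A Cauchy sequence converges uniformly, a uniform limit of
  convergent sequences converges, and the assumption \<open>closed\<close> places the limit in \<open>M\<close>.
\<close>

lemma polish_sequence_group_sup:
  assumes conv: "\<And>x. x \<in> M \<Longrightarrow> convergent x"
    and diff: "\<And>x y. x \<in> M \<Longrightarrow> y \<in> M \<Longrightarrow> x - y \<in> M"
    and prep: "\<And>t x. prepend (t, x) \<in> M \<longleftrightarrow> x \<in> M"
    and closed: "\<And>x. convergent x \<Longrightarrow> (\<And>e. e > 0 \<Longrightarrow> \<exists>y\<in>M. \<forall>n. \<bar>x n - y n\<bar> \<le> e) \<Longrightarrow> x \<in> M"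
    and Z: "countable Z" "Z \<subseteq> M" "Z \<noteq> {}"
    and tails: "\<And>x e. x \<in> M \<Longrightarrow> e > 0 \<Longrightarrow> \<exists>m. \<exists>z\<in>Z. \<forall>n\<ge>m. \<bar>x n - z (n - m)\<bar> \<le> e"
  shows "polish_sequence_group M sup_norm Z"
proof -
  interpret Metric_space M "\<lambda>x y. sup_norm (x - y)"
    using conv by (rule Metric_space_sup)
  have bdd: "bounded (range x)" if "x \<in> M" for x
    using conv[OF that] by (rule convergent_imp_bounded_range)
  have coord: "\<bar>x n - y n\<bar> \<le> sup_norm (x - y)" if "x \<in> M" "y \<in> M" for x y n
    using sup_norm_ge[OF bdd[OF diff[OF that]], of n] by simp
  have tail: "tail x \<in> M" if "x \<in> M" for x
    using prep[of "x 0" "tail x"] that by simp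
  show ?thesis
  proof unfold_locales
    fix x t assume x: "x \<in> M"
    show "sup_norm (prepend (t, x)) \<le> \<bar>t\<bar> + sup_norm x"
    proof (rule sup_norm_le)
      show "bounded (range (prepend (t, x)))" using x prep bdd by blast
      show "\<bar>prepend (t, x) n\<bar> \<le> \<bar>t\<bar> + sup_norm x" for n
        using sup_norm_ge[OF bdd[OF x]] sup_norm_nonneg[of x]
        by (cases n) (auto intro: add_increasing)
    qed
    show "\<bar>x 0\<bar> \<le> sup_norm x" using sup_norm_ge[OF bdd[OF x]] .
    show "sup_norm (tail x) \<le> sup_norm x"
      using sup_norm_ge[OF bdd[OF x]] bdd[OF tail[OF x]]
      by (intro sup_norm_le) (auto simp: tail_def)
  next
    show mcomplete
    proof (rule mcompleteI)
      fix \<sigma> :: "nat \<Rightarrow> nat \<Rightarrow> real"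
      assume \<sigma>: "range \<sigma> \<subseteq> M"
        and cauchy: "\<And>e. e > 0 \<Longrightarrow> \<exists>k. \<forall>m\<ge>k. \<forall>n\<ge>k. sup_norm (\<sigma> m - \<sigma> n) \<le> e"
      have \<sigma>M: "\<sigma> n \<in> M" for n using \<sigma> by blast
      obtain l where l: "\<And>i. (\<lambda>n. \<sigma> n i) \<longlonglongrightarrow> l i"
        using coordinates_converge[OF coord \<sigma> cauchy] by blast
      have unif: "\<exists>k. \<forall>n\<ge>k. \<forall>i. \<bar>\<sigma> n i - l i\<bar> \<le> e" if e: "e > 0" for e
      proof -
        obtain k where k: "\<And>m n. m \<ge> k \<Longrightarrow> n \<ge> k \<Longrightarrow> sup_norm (\<sigma> m - \<sigma> n) \<le> e"
          using cauchy[OF e] by blast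
        have "\<bar>\<sigma> n i - l i\<bar> \<le> e" if "n \<ge> k" for n i
        proof (rule tendsto_upperbound)
          show "(\<lambda>m. \<bar>\<sigma> n i - \<sigma> m i\<bar>) \<longlonglongrightarrow> \<bar>\<sigma> n i - l i\<bar>" by (intro tendsto_intros l)
          show "\<forall>\<^sub>F m in sequentially. \<bar>\<sigma> n i - \<sigma> m i\<bar> \<le> e"
            using eventually_ge_at_top[of k]
          proof eventually_elim
            fix m assume "m \<ge> k"
            then show "\<bar>\<sigma> n i - \<sigma> m i\<bar> \<le> e"
              using coord[OF \<sigma>M \<sigma>M, of n i m] k[OF \<open>n \<ge> k\<close>, of m] by linarith
          qed
        qed simp
        then show ?thesis by blast
      qed
      have "convergent l"
      proof (rule Cauchy_convergent, rule CauchyI)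
        fix e :: real assume "e > 0"
        then obtain n where n: "\<And>i. \<bar>\<sigma> n i - l i\<bar> \<le> e / 4" using unif[of "e/4"] by auto
        have "Cauchy (\<sigma> n)" using conv[OF \<sigma>M] by (rule convergent_Cauchy)
        then obtain k where k: "\<And>i j. i \<ge> k \<Longrightarrow> j \<ge> k \<Longrightarrow> norm (\<sigma> n i - \<sigma> n j) < e / 4"
          using CauchyD[of "\<sigma> n" "e/4"] \<open>e > 0\<close> by auto
        have "norm (l i - l j) < e" if "i \<ge> k" "j \<ge> k" for i j
          using n[of i] n[of j] k[OF that] \<open>e > 0\<close> unfolding real_norm_def by linarith
        then show "\<exists>k. \<forall>i\<ge>k. \<forall>j\<ge>k. norm (l i - l j) < e" by blast
      qed
      then have lM: "l \<in> M"
      proof (rule closed)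
        fix e :: real assume "e > 0"
        then obtain n where "\<And>i. \<bar>\<sigma> n i - l i\<bar> \<le> e" using unif by blast
        then show "\<exists>y\<in>M. \<forall>i. \<bar>l i - y i\<bar> \<le> e"
          using \<sigma>M by (intro bexI[of _ "\<sigma> n"]) (auto simp: abs_minus_commute)
      qed
      have "\<exists>k. \<forall>n\<ge>k. sup_norm (\<sigma> n - l) \<le> e" if e: "e > 0" for e
      proof -
        obtain k where k: "\<And>n i. n \<ge> k \<Longrightarrow> \<bar>\<sigma> n i - l i\<bar> \<le> e" using unif[OF e] by blast
        have "sup_norm (\<sigma> n - l) \<le> e" if "n \<ge> k" for n
          using bdd[OF diff[OF \<sigma>M lM]] k[OF that] by (intro sup_norm_le) auto
        then show ?thesis by blast
      qed
      then show "\<exists>l\<in>M. \<forall>e>0. \<exists>k. \<forall>n\<ge>k. sup_norm (\<sigma> n - l) \<le> e" using lM by blast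
    qed
  next
    fix x and e :: real assume x: "x \<in> M" and e: "e > 0"
    obtain m z where z: "z \<in> Z" "\<And>n. n \<ge> m \<Longrightarrow> \<bar>x n - z (n - m)\<bar> \<le> e / 2"
      using tails[OF x, of "e/2"] e by auto
    have "(tail ^^ m) x \<in> M" using x tail by (induction m) auto
    then have "bounded (range ((tail ^^ m) x - z))" using z(1) Z(2) diff bdd by blast
    moreover have "\<bar>((tail ^^ m) x - z) n\<bar> \<le> e / 2" for n
      using z(2)[of "n + m"] by (simp add: tail_funpow)
    ultimately have "sup_norm ((tail ^^ m) x - z) \<le> e / 2" by (rule sup_norm_le)
    then show "\<exists>m. \<exists>z\<in>Z. sup_norm ((tail ^^ m) x - z) < e"
      using z(1) e by (intro exI[of _ m] bexI[of _ z]) auto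
  qed (use diff prep Z in auto)
qed

lemma LIMSEQ_prepend_iff: "prepend (t, x) \<longlonglongrightarrow> l \<longleftrightarrow> x \<longlonglongrightarrow> l"
  using filterlim_sequentially_Suc[of "prepend (t, x)" "nhds l"] by simp

lemma polish_sequence_group_c0: "polish_sequence_group c0_seqs sup_norm {0}"
proof (rule polish_sequence_group_sup)
  fix x :: "nat \<Rightarrow> real"
  assume close: "\<And>e. e > 0 \<Longrightarrow> \<exists>y\<in>c0_seqs. \<forall>n. \<bar>x n - y n\<bar> \<le> e"
  have "x \<longlonglongrightarrow> 0"
  proof (rule LIMSEQ_I)
    fix e :: real assume "e > 0"
    then obtain y where y: "y \<longlonglongrightarrow> 0" "\<And>n. \<bar>x n - y n\<bar> \<le> e / 2"
      using close[of "e/2"] by (auto simp: c0_seqs_def)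
    obtain k where k: "\<And>n. n \<ge> k \<Longrightarrow> norm (y n - 0) < e / 2"
      using LIMSEQ_D[OF y(1), of "e/2"] \<open>e > 0\<close> by auto
    have "norm (x n - 0) < e" if "n \<ge> k" for n
      using k[OF that] y(2)[of n] unfolding real_norm_def by linarith
    then show "\<exists>k. \<forall>n\<ge>k. norm (x n - 0) < e" by blast
  qed
  then show "x \<in> c0_seqs" by (simp add: c0_seqs_def)
next
  fix x :: "nat \<Rightarrow> real" and e :: real assume "x \<in> c0_seqs" "e > 0"
  then obtain k where "\<And>n. n \<ge> k \<Longrightarrow> norm (x n - 0) < e"
    using LIMSEQ_D[of x 0 e] by (auto simp: c0_seqs_def)
  then show "\<exists>m. \<exists>z\<in>{0}. \<forall>n\<ge>m. \<bar>x n - z (n - m)\<bar> \<le> e"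
    by (intro exI[of _ k]) (auto intro: less_imp_le)
next
  show "x - y \<in> c0_seqs" if "x \<in> c0_seqs" "y \<in> c0_seqs" for x y
    using tendsto_diff[of x 0 sequentially y 0] that by (simp add: c0_seqs_def fun_diff_def)
qed (auto simp: c0_seqs_def convergent_def LIMSEQ_prepend_iff zero_fun_def)

lemma polish_sequence_group_c: "polish_sequence_group c_seqs sup_norm (range (\<lambda>r n. real_of_rat r))"
proof (rule polish_sequence_group_sup)
  fix x :: "nat \<Rightarrow> real" and e :: real assume "x \<in> c_seqs" "e > 0"
  then obtain l where l: "x \<longlonglongrightarrow> l" by (auto simp: c_seqs_def convergent_def)
  obtain k where k: "\<And>n. n \<ge> k \<Longrightarrow> norm (x n - l) < e / 2"
    using LIMSEQ_D[OF l, of "e/2"] \<open>e > 0\<close> by auto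
  obtain r where r: "l < real_of_rat r" "real_of_rat r < l + e / 2"
    using of_rat_dense[of l "l + e / 2"] \<open>e > 0\<close> by auto
  have "\<bar>x n - real_of_rat r\<bar> \<le> e" if "n \<ge> k" for n
    using k[OF that] r unfolding real_norm_def by linarith
  then show "\<exists>m. \<exists>z\<in>range (\<lambda>r n. real_of_rat r). \<forall>n\<ge>m. \<bar>x n - z (n - m)\<bar> \<le> e"
    by (intro exI[of _ k] bexI[of _ "\<lambda>n. real_of_rat r"]) auto
next
  show "x - y \<in> c_seqs" if "x \<in> c_seqs" "y \<in> c_seqs" for x y
    using convergent_diff[of x y] that by (simp add: c_seqs_def fun_diff_def)
qed (auto simp: c_seqs_def LIMSEQ_prepend_iff convergent_const convergent_def)

section \<open>The spaces \<open>l\<^sub>p\<close>\<close>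

lemma lp_prepend:
  assumes "x \<in> lp_seqs p"
  shows "prepend (t, x) \<in> lp_seqs p"
    and "(\<Sum>n. \<bar>prepend (t, x) n\<bar> powr p) = \<bar>t\<bar> powr p + (\<Sum>n. \<bar>x n\<bar> powr p)"
  using assms suminf_split_head[of "\<lambda>n. \<bar>prepend (t, x) n\<bar> powr p"]
    summable_Suc_iff[of "\<lambda>n. \<bar>prepend (t, x) n\<bar> powr p"]
  by (simp_all add: lp_seqs_def)

lemma powr_mono_base_iff:
  fixes a b p :: real
  assumes "0 < p" "0 \<le> a" "0 \<le> b"
  shows "a powr p \<le> b powr p \<longleftrightarrow> a \<le> b"
  using assms powr_mono2[of p a b] powr_less_mono2[of p b a] by fastforce

lemma lp_norm_le_iff:
  assumes "1 \<le> p" "x \<in> lp_seqs p" "0 \<le> C"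
  shows "lp_norm p x \<le> C \<longleftrightarrow> (\<Sum>n. \<bar>x n\<bar> powr p) \<le> C powr p"
  using assms powr_mono_base_iff[of p "lp_norm p x" C]
  by (simp add: lp_norm_nonneg flip: lp_norm_powr)

text \<open>
  Fatou's lemma for the \<open>p\<close>-norm: each finite partial sum passes to the limit.  Applied to the
  differences of a Cauchy sequence it gives both the membership of the limit and the convergence
  in norm.
\<close>

lemma lp_norm_fatou:
  assumes p: "1 \<le> p" and C: "0 \<le> C"
    and y: "\<And>k. y k \<in> lp_seqs p" "\<And>i. (\<lambda>k. y k i) \<longlonglongrightarrow> x i"
    and le: "\<forall>\<^sub>F k in sequentially. lp_norm p (y k) \<le> C"
  shows "x \<in> lp_seqs p \<and> lp_norm p x \<le> C"
proof -
  have partial: "(\<Sum>i<n. \<bar>x i\<bar> powr p) \<le> C powr p" for n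
  proof (rule tendsto_upperbound)
    show "(\<lambda>k. \<Sum>i<n. \<bar>y k i\<bar> powr p) \<longlonglongrightarrow> (\<Sum>i<n. \<bar>x i\<bar> powr p)"
      using p by (intro tendsto_intros y(2) tendsto_powr') auto
    show "\<forall>\<^sub>F k in sequentially. (\<Sum>i<n. \<bar>y k i\<bar> powr p) \<le> C powr p"
      using le
    proof eventually_elim
      fix k assume "lp_norm p (y k) \<le> C"
      moreover have "(\<Sum>i<n. \<bar>y k i\<bar> powr p) \<le> (\<Sum>i. \<bar>y k i\<bar> powr p)"
        using y(1)[of k] by (intro sum_le_suminf) (auto simp: lp_seqs_def)
      ultimately show "(\<Sum>i<n. \<bar>y k i\<bar> powr p) \<le> C powr p"
        using lp_norm_le_iff[OF p y(1) C] order_trans by blast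
    qed
  qed simp
  have sm: "summable (\<lambda>i. \<bar>x i\<bar> powr p)"
    using partial[of "Suc _"] unfolding lessThan_Suc_atMost
    by (intro bounded_imp_summable[where B = "C powr p"]) auto
  then have x: "x \<in> lp_seqs p" by (simp add: lp_seqs_def)
  moreover have "(\<Sum>i. \<bar>x i\<bar> powr p) \<le> C powr p"
    using suminf_le_const[OF sm] partial by blast
  ultimately show ?thesis using lp_norm_le_iff[OF p x C] by blast
qed

lemma polish_sequence_group_lp:
  assumes p: "1 \<le> p"
  shows "polish_sequence_group (lp_seqs p) (lp_norm p) {0}"
proof -
  interpret Metric_space "lp_seqs p" "\<lambda>x y. lp_norm p (x - y)"
    using p by (rule Metric_space_lp)
  have diff: "x - y \<in> lp_seqs p" if "x \<in> lp_seqs p" "y \<in> lp_seqs p" for x y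
  proof -
    have "- y \<in> lp_seqs p" using that by (simp add: lp_seqs_def)
    then show ?thesis using lp_norm_triangle[OF p that(1)] by fastforce
  qed
  have zero: "0 \<in> lp_seqs p" by (simp add: lp_seqs_def)
  have tail: "tail x \<in> lp_seqs p" if "x \<in> lp_seqs p" for x
    using that summable_Suc_iff[of "\<lambda>n. \<bar>x n\<bar> powr p"] by (simp add: lp_seqs_def tail_def)
  have entry: "\<bar>x n\<bar> \<le> lp_norm p x" if "x \<in> lp_seqs p" for x n
  proof -
    have "\<bar>x n\<bar> powr p \<le> (\<Sum>n. \<bar>x n\<bar> powr p)"
      using that sum_le_suminf[of "\<lambda>n. \<bar>x n\<bar> powr p" "{n}"] by (simp add: lp_seqs_def)
    then have "\<bar>x n\<bar> powr p \<le> lp_norm p x powr p" using lp_norm_powr[OF p that] by simp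
    then show ?thesis using powr_mono_base_iff[of p "\<bar>x n\<bar>" "lp_norm p x"] p lp_norm_nonneg by simp
  qed
  show ?thesis
  proof unfold_locales
    fix x t assume x: "x \<in> lp_seqs p"
    have "prepend (t, 0) + prepend (0, x) = prepend (t, x)"
      by (auto simp: prepend_def fun_eq_iff split: nat.split)
    then have "lp_norm p (prepend (t, x)) \<le> lp_norm p (prepend (t, 0)) + lp_norm p (prepend (0, x))"
      using lp_norm_triangle[OF p lp_prepend(1)[OF zero, of t] lp_prepend(1)[OF x, of 0]] by simp
    moreover have "lp_norm p (prepend (t, 0)) = \<bar>t\<bar>"
      using p lp_prepend(2)[OF zero, of t] by (simp add: lp_norm_def powr_powr)
    moreover have "lp_norm p (prepend (0, x)) = lp_norm p x"
      using lp_prepend(2)[OF x, of 0] p by (simp add: lp_norm_def)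
    ultimately show "lp_norm p (prepend (t, x)) \<le> \<bar>t\<bar> + lp_norm p x" by simp
    show "\<bar>x 0\<bar> \<le> lp_norm p x" by (rule entry[OF x])
    have "(\<Sum>n. \<bar>tail x n\<bar> powr p) \<le> (\<Sum>n. \<bar>x n\<bar> powr p)"
      using lp_prepend(2)[OF tail[OF x], of "x 0"] by simp
    then show "lp_norm p (tail x) \<le> lp_norm p x"
      unfolding lp_norm_le_iff[OF p tail[OF x] lp_norm_nonneg] lp_norm_powr[OF p x] .
  next
    show mcomplete
    proof (rule mcompleteI)
      fix \<sigma> :: "nat \<Rightarrow> nat \<Rightarrow> real"
      assume \<sigma>: "range \<sigma> \<subseteq> lp_seqs p"
        and cauchy: "\<And>e. e > 0 \<Longrightarrow> \<exists>k. \<forall>m\<ge>k. \<forall>n\<ge>k. lp_norm p (\<sigma> m - \<sigma> n) \<le> e"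
      have \<sigma>M: "\<sigma> n \<in> lp_seqs p" for n using \<sigma> by blast
      have coord: "\<bar>x n - y n\<bar> \<le> lp_norm p (x - y)" if "x \<in> lp_seqs p" "y \<in> lp_seqs p" for x y n
        using entry[OF diff[OF that], of n] by simp
      obtain l where l: "\<And>i. (\<lambda>n. \<sigma> n i) \<longlonglongrightarrow> l i"
        using coordinates_converge[OF coord \<sigma> cauchy] by blast
      have close: "\<exists>k. \<forall>n\<ge>k. \<sigma> n - l \<in> lp_seqs p \<and> lp_norm p (\<sigma> n - l) \<le> e" if e: "e > 0" for e
      proof -
        obtain k where k: "\<And>m n. m \<ge> k \<Longrightarrow> n \<ge> k \<Longrightarrow> lp_norm p (\<sigma> m - \<sigma> n) \<le> e"
          using cauchy[OF e] by blast
        have "\<sigma> n - l \<in> lp_seqs p \<and> lp_norm p (\<sigma> n - l) \<le> e" if n: "n \<ge> k" for n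
        proof (rule lp_norm_fatou[OF p])
          show "0 \<le> e" using e by simp
          show "\<sigma> n - \<sigma> m \<in> lp_seqs p" for m by (intro diff \<sigma>M)
          show "(\<lambda>m. (\<sigma> n - \<sigma> m) i) \<longlonglongrightarrow> (\<sigma> n - l) i" for i
            using tendsto_diff[OF tendsto_const l] by simp
          show "\<forall>\<^sub>F m in sequentially. lp_norm p (\<sigma> n - \<sigma> m) \<le> e"
            using eventually_mono[OF eventually_ge_at_top[of k] k[OF n]] .
        qed
        then show ?thesis by blast
      qed
      obtain n where "\<sigma> n - l \<in> lp_seqs p" using close[of 1] by auto
      then have "l \<in> lp_seqs p" using diff[OF \<sigma>M, of "\<sigma> n - l" n] by simp
      then show "\<exists>l\<in>lp_seqs p. \<forall>e>0. \<exists>k. \<forall>n\<ge>k. lp_norm p (\<sigma> n - l) \<le> e"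
        using close by blast
    qed
  next
    fix x and e :: real assume x: "x \<in> lp_seqs p" and e: "e > 0"
    have "summable (\<lambda>n. \<bar>x n\<bar> powr p)" using x by (simp add: lp_seqs_def)
    then obtain m where m: "norm (\<Sum>n. \<bar>x (n + m)\<bar> powr p) < (e / 2) powr p"
      using suminf_exist_split[of "(e / 2) powr p" "\<lambda>n. \<bar>x n\<bar> powr p"] e by auto
    have "(tail ^^ m) x \<in> lp_seqs p" using x tail by (induction m) auto
    then have "lp_norm p ((tail ^^ m) x) \<le> e / 2"
      using m e by (subst lp_norm_le_iff[OF p]) (auto simp: tail_funpow)
    then show "\<exists>m. \<exists>z\<in>{0}. lp_norm p ((tail ^^ m) x - z) < e"
      using e by (intro exI[of _ m]) auto
  next
    show "prepend (t, x) \<in> lp_seqs p \<longleftrightarrow> x \<in> lp_seqs p" for t x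
      using lp_prepend(1)[of x p t] tail[of "prepend (t, x)"] by auto
  qed (use diff zero in auto)
qed

section \<open>Haar meager sets that are not Haar null\<close>

theorem mainTheorem1:
  fixes X :: "(nat \<Rightarrow> real) topology"
  assumes "X = mtopology_of c0_metric \<or> X = mtopology_of c_metric \<or>
           (\<exists>p\<ge>1. X = mtopology_of (lp_metric p))"
  shows "(\<forall>(A :: (nat \<Rightarrow> real) set) (B :: real set) S.
            A \<in> sets (borel_of X) \<inter> catches_compacts X \<longrightarrow>
            B \<in> sets lebesgue \<longrightarrow> meager_in euclidean B \<longrightarrow> emeasure lebesgue B > 0 \<longrightarrow>
            S = prepend ` (B \<times> A) \<longrightarrow>
            haar_meager X S \<and> meager_in X S \<and> \<not> haar_null X S) \<and>
         (\<exists>S \<subseteq> topspace X. haar_meager X S \<and> meager_in X S \<and> \<not> haar_null X S)"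
proof -
  obtain M N Z where MN: "polish_sequence_group M N Z"
    and X: "X = mtopology_of (metric (M, \<lambda>x y. N (x - y)))"
    using assms polish_sequence_group_c0 polish_sequence_group_c polish_sequence_group_lp
    unfolding c0_metric_def c_metric_def lp_metric_def by blast
  interpret polish_sequence_group M N Z by fact
  have "X = mtopology" unfolding X by simp
  then show ?thesis using haar_meager_not_haar_null by simp
qed

end
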